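(* Let $H_k=(D_1,D_2,D_3)$ be a partition of the columns of the saturated two-level design $H_k$ with $2^k$ runs and $2^k-1$ factors, where $D_1$ has $m$ columns and $D_2$ has $S$ columns. For $2\le j\le m$ let $$N_j(D_1,D_2)=(j+1)A_{j+1}(D_1)+(m-j+1)A_{j-1}(D_1)+B_j(D_1,D_2).$$ Then $$\begin{aligned}N_j(D_1,D_2)=&\sum_{i=0}^{j+1}\bigl[(j+1-S)\,c_m(i,j+1)+S\,c_{m+1}(i,j+1)\bigr]A_i(D_2\cup D_3)\\&-\sum_{i=0}^{j+1}c_{m+1}(i,j+1)\,E_i(D_2,D_3)\\&+(m-j+1)\sum_{i=0}^{j-1}c_m(i,j-1)\,A_i(D_2\cup D_3),\end{aligned}$$ where $E_i(D_2,D_3)=\sum_{p=1}^{i}p\,E_i^{(p)}(D_2,D_3)$ and $E_i^{(p)}(D_2,D_3)$ is the number of length-$i$ defining words in $D_2\cup D_3$ that have exactly $p$ letters from $D_2$.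
   Context: The saturated design $H_k$ of $n=2^k$ runs and $n-1$ factors is the $n\times(n-1)$ matrix with entries $\pm1$ whose columns are all entrywise products of nonempty subsets of $k$ independent columns $a_1,\ldots,a_k$ (the columns of a full $2^k$ factorial). For a set $D$ of columns of $H_k$, a defining word of length $i$ in $D$ is a set of $i$ columns (letters) of $D$ whose entrywise product is the all-ones column; $A_i(D)$ is the number of such words, with $A_0(D)=1$ (the empty word). $B_j(D_1,D_2)$ is the number of length-$(j+1)$ defining words in $(D_1,D_2)$ that have $j$ letters from $D_1$ and one letter from $D_2$. $E_0(D_2,D_3)=0$ (empty sum). The coefficients are, for an integer $m$ (and likewise with $m$ replaced by $m+1$; $k$ fixed) and $j\ge1$: $c_m(1,j)=c_m(2,j)=0$; for $3\le i\le j$, $$c_m(i,j)=(-1)^{j-[(j-i)/2]}\binom{m-2^{k-1}}{[(j-i)/2]};$$ and $$c_m(0,j)=(-1)^{j-[j/2]}\binom{m-2^{k-1}}{[j/2]}+2^{-k}\bigl[P_j(0;m)-P_j(2^{k-1};m)\bigr],$$ where $[x]$ is the integer part of $x$ and $P_j(x;m)=\sum_{s=0}^{j}(-1)^s\binom{x}{s}\binom{m-x}{j-s}$ is a Krawtchouk polynomial. Binomial coefficients are generalized: $\binom{x}{s}=x(x-1)\cdots(x-s+1)/s!$ for any integer $x$ (possibly negative) and integer $s\ge0$. *)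

theory Defs
  imports Complex_Main "Jordan_Normal_Form.Matrix"
begin

section \<open>Two-level designs\<close>

text \<open>Rows are runs and columns are factors; a design column is an integer vector with
  entries 1 and -1.  As there are \<open>2 ^ k\<close> rows and \<open>2 ^ k\<close> sign patterns, the condition on the
  set of rows says that each level combination occurs in exactly one run.\<close>

definition full_factorial :: "nat \<Rightarrow> int mat \<Rightarrow> bool" where
  "full_factorial k F \<longleftrightarrow>
     F \<in> carrier_mat (2 ^ k) k \<and>
     set (rows F) = {v \<in> carrier_vec k. \<forall>i<k. v $ i \<in> {1, -1}}"

definition entrywise_prod :: "nat \<Rightarrow> int vec set \<Rightarrow> int vec" where
  "entrywise_prod n W = vec n (\<lambda>r. \<Prod>c\<in>W. c $ r)"

abbreviation ones_vec :: "nat \<Rightarrow> int vec" where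
  "ones_vec n \<equiv> vec n (\<lambda>_. 1)"

text \<open>The \<open>2 ^ k - 1\<close> nonempty sets of independent columns have pairwise different products, so
  the condition on the set of columns fixes the matrix up to the order of its columns (for a
  given \<open>F\<close>), and the columns of the design may be identified with a set of vectors.\<close>

definition saturated_design :: "nat \<Rightarrow> int mat \<Rightarrow> bool" where
  "saturated_design k H \<longleftrightarrow>
     H \<in> carrier_mat (2 ^ k) (2 ^ k - 1) \<and>
     (\<exists>F. full_factorial k F \<and>
          set (cols H) = {entrywise_prod (2 ^ k) W | W. W \<subseteq> set (cols F) \<and> W \<noteq> {}})"

section \<open>Defining words\<close>

text \<open>In what follows \<open>n\<close> is the number of runs, i.e. the length of the columns.\<close>

definition defining_words :: "nat \<Rightarrow> int vec set \<Rightarrow> nat \<Rightarrow> int vec set set" where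
  "defining_words n D i = {W. W \<subseteq> D \<and> finite W \<and> card W = i \<and> entrywise_prod n W = ones_vec n}"

definition A_words :: "nat \<Rightarrow> int vec set \<Rightarrow> nat \<Rightarrow> nat" where
  "A_words n D i = card (defining_words n D i)"

lemma A_words_0: "A_words n D 0 = 1"
proof -
  have "defining_words n D 0 = {{}}"
    by (auto simp: defining_words_def entrywise_prod_def)
  then show ?thesis by (simp add: A_words_def)
qed

definition B_words :: "nat \<Rightarrow> int vec set \<Rightarrow> int vec set \<Rightarrow> nat \<Rightarrow> nat" where
  "B_words n D1 D2 j =
     card {W \<in> defining_words n (D1 \<union> D2) (j + 1). card (W \<inter> D1) = j \<and> card (W \<inter> D2) = 1}"

definition E_words_exact :: "nat \<Rightarrow> int vec set \<Rightarrow> int vec set \<Rightarrow> nat \<Rightarrow> nat \<Rightarrow> nat" where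
  "E_words_exact n D2 D3 p i = card {W \<in> defining_words n (D2 \<union> D3) i. card (W \<inter> D2) = p}"

definition E_words :: "nat \<Rightarrow> int vec set \<Rightarrow> int vec set \<Rightarrow> nat \<Rightarrow> nat" where
  "E_words n D2 D3 i = (\<Sum>p=1..i. p * E_words_exact n D2 D3 p i)"

text \<open>Here \<open>m\<close> stands for the number of columns of \<open>D1\<close>.\<close>

definition N_words :: "nat \<Rightarrow> nat \<Rightarrow> int vec set \<Rightarrow> int vec set \<Rightarrow> nat \<Rightarrow> real" where
  "N_words n m D1 D2 j =
     (real j + 1) * real (A_words n D1 (j + 1))
     + (real m - real j + 1) * real (A_words n D1 (j - 1))
     + real (B_words n D1 D2 j)"

section \<open>Coefficients\<close>

definition krawtchouk :: "nat \<Rightarrow> int \<Rightarrow> int \<Rightarrow> real" where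
  "krawtchouk j x m =
     (\<Sum>s=0..j. (-1) ^ s * (of_int x gchoose s) * (of_int (m - x) gchoose (j - s)))"

text \<open>Only arguments with \<open>i \<le> j\<close> and \<open>1 \<le> j\<close> are meaningful, so the truncated subtraction
  \<open>j - i\<close> is harmless; \<open>k\<close> and \<open>m\<close> come first.\<close>

definition c_coeff :: "nat \<Rightarrow> int \<Rightarrow> nat \<Rightarrow> nat \<Rightarrow> real" where
  "c_coeff k m i j =
     (if i = 0 then
        (-1) ^ (j - j div 2) * (of_int (m - 2 ^ (k - 1)) gchoose (j div 2))
        + (krawtchouk j 0 m - krawtchouk j (2 ^ (k - 1)) m) / 2 ^ k
      else if i = 1 \<or> i = 2 then 0
      else (-1) ^ (j - (j - i) div 2) * (of_int (m - 2 ^ (k - 1)) gchoose ((j - i) div 2)))"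

end

theory Submission
  imports Defs "HOL-Computational_Algebra.Formal_Power_Series"
begin

text \<open>Write \<open>W\<^sub>D(X) = \<Sum>i. A\<^sub>i(D) X\<^sup>i\<close> and \<open>n = 2\<^sup>k\<close>.  A product of columns of the saturated design is
  the all-ones column or a column with sum 0, so averaging over the runs picks out the defining
  words:  \<open>n W\<^sub>D(X)\<close> is the sum over the runs \<open>r\<close> of \<open>\<Prod>c\<in>D. (1 + c\<^sub>r X) = (1 + X)\<^sup>a (1 - X)\<^sup>b\<close>, where
  \<open>a\<close> and \<open>b\<close> count the entries \<open>1\<close> and \<open>-1\<close> of the run in \<open>D\<close>.

  One run of the design consists of ones only, and every other run has entry sum \<open>-1\<close>, that is
  \<open>2 ^ (k - 1) - 1\<close> entries \<open>1\<close> and \<open>2 ^ (k - 1)\<close> entries \<open>-1\<close>.  Hence in all runs but one the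
  numbers \<open>a, b\<close> for \<open>D\<close> are determined by those for the complement of \<open>D\<close>: the row polynomial of
  \<open>D\<close> is that of the complement, taken at \<open>-X\<close>, times the same factor
  \<open>(1 - X) (1 - X\<^sup>2) ^ M\<close> with \<open>M = card D - 2 ^ (k - 1)\<close>.  The exponent may be negative, which is
  why this is done with binomial power series.  Comparing coefficients gives the MacWilliams-type
  identity \<open>A_words_complement\<close>: the \<open>A\<^sub>j(D)\<close> are combinations of the word counts of the
  complement, with the \<open>c_coeff\<close> as coefficients; the exceptional run contributes the Krawtchouk
  terms of the coefficient with index 0.

  A word with \<open>j\<close> letters in \<open>D1\<close> and one letter \<open>d\<close> in \<open>D2\<close> is a word of length \<open>j + 1\<close> in
  \<open>insert d D1\<close> that is not a word in \<open>D1\<close> (\<open>B_words_eq_sum_A_words\<close>).  The complement of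
  \<open>insert d D1\<close> is \<open>D2 \<union> D3 - {d}\<close>.  Summed over \<open>d\<close>, a word in \<open>D2 \<union> D3\<close> with \<open>p\<close> letters in
  \<open>D2\<close> survives the deletion of \<open>d\<close> exactly \<open>S - p\<close> times, which produces \<open>S A\<^sub>i - E\<^sub>i\<close>
  (\<open>sum_A_words_delete\<close>).  Inserting this, and the identity for \<open>D1\<close> itself, into the
  definition of \<open>N_words\<close> proves the theorem.\<close>

section \<open>Orthogonality in the saturated design\<close>

definition sign_vectors :: "nat \<Rightarrow> int vec set" where
  "sign_vectors k = {v \<in> carrier_vec k. \<forall>i<k. v $ i \<in> {1, -1}}"

lemma finite_sign_vectors: "finite (sign_vectors k)"
  and card_sign_vectors: "card (sign_vectors k) = 2 ^ k"
proof -
  have "bij_betw (\<lambda>N. vec k (\<lambda>i. if i \<in> N then -1 else 1)) (Pow {..<k}) (sign_vectors k)"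
  proof (rule bij_betwI[where g = "\<lambda>v. {i. i < k \<and> v $ i = -1}"])
    show "(\<lambda>N. vec k (\<lambda>i. if i \<in> N then -1 else 1)) \<in> Pow {..<k} \<rightarrow> sign_vectors k"
      by (simp add: sign_vectors_def)
    show "(\<lambda>v. {i. i < k \<and> v $ i = -1}) \<in> sign_vectors k \<rightarrow> Pow {..<k}"
      by auto
    show "{i. i < k \<and> vec k (\<lambda>i. if i \<in> N then -1 else (1 :: int)) $ i = -1} = N"
      if "N \<in> Pow {..<k}" for N
    proof -
      have "{i. i < k \<and> vec k (\<lambda>i. if i \<in> N then -1 else (1 :: int)) $ i = -1} = {i. i < k \<and> i \<in> N}"
        by (auto simp: index_vec split: if_splits)
      then show ?thesis using that by auto
    qed
    show "vec k (\<lambda>i. if i \<in> {i. i < k \<and> v $ i = -1} then -1 else 1) = v"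
      if "v \<in> sign_vectors k" for v
    proof (rule eq_vecI)
      fix i assume "i < dim_vec v"
      then have i: "i < k" and "v $ i = 1 \<or> v $ i = -1"
        using that by (auto simp: sign_vectors_def)
      then show "vec k (\<lambda>i. if i \<in> {i. i < k \<and> v $ i = -1} then -1 else 1) $ i = v $ i"
        by (simp only: index_vec[OF i]) auto
    qed (use that in \<open>auto simp: sign_vectors_def\<close>)
  qed
  then have "finite (sign_vectors k) = finite (Pow {..<k})"
    and "card (sign_vectors k) = card (Pow {..<k})"
    using bij_betw_finite bij_betw_same_card by metis+
  then show "finite (sign_vectors k)" and "card (sign_vectors k) = 2 ^ k"
    by (simp_all add: card_Pow)
qed

text \<open>Flipping the sign of one coordinate in \<open>I\<close> permutes the sign vectors and negates the product,
  so the sum is its own negative.\<close>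

lemma sum_prod_sign_vectors_eq_0:
  assumes "I \<subseteq> {..<k}" and "I \<noteq> {}"
  shows "(\<Sum>v\<in>sign_vectors k. \<Prod>i\<in>I. v $ i) = 0"
proof -
  obtain i0 where i0: "i0 \<in> I" using assms(2) by blast
  have fin: "finite I" using assms(1) finite_subset by blast
  define flip :: "int vec \<Rightarrow> int vec" where
    "flip v = vec k (\<lambda>i. if i = i0 then - v $ i else v $ i)" for v
  have flip_in: "flip v \<in> sign_vectors k" if "v \<in> sign_vectors k" for v
    using that by (auto simp: flip_def sign_vectors_def)
  have flip_flip: "flip (flip v) = v" if "v \<in> sign_vectors k" for v
    using that by (intro eq_vecI) (auto simp: flip_def sign_vectors_def)
  have neg: "(\<Prod>i\<in>I. flip v $ i) = - (\<Prod>i\<in>I. v $ i)" for v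
  proof -
    have "(\<Prod>i\<in>I - {i0}. flip v $ i) = (\<Prod>i\<in>I - {i0}. v $ i)"
      using assms(1) by (intro prod.cong) (auto simp: flip_def)
    moreover have "flip v $ i0 = - v $ i0" using i0 assms(1) by (auto simp: flip_def)
    ultimately show ?thesis by (simp add: prod.remove[OF fin i0])
  qed
  have "(\<Sum>v\<in>sign_vectors k. \<Prod>i\<in>I. v $ i) = (\<Sum>v\<in>sign_vectors k. \<Prod>i\<in>I. flip v $ i)"
    by (rule sum.reindex_bij_witness[where i = flip and j = flip]) (auto simp: flip_in flip_flip)
  then show ?thesis by (simp add: neg sum_negf)
qed

text \<open>The rows cover all \<open>2 ^ k\<close> sign vectors and there are only \<open>2 ^ k\<close> of them, so no sign vector
  is repeated.\<close>

lemma full_factorial_row_bij: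
  assumes "full_factorial k F"
  shows "bij_betw (row F) {..<2 ^ k} (sign_vectors k)"
proof -
  have img: "row F ` {..<2 ^ k} = sign_vectors k"
    using assms by (auto simp: full_factorial_def sign_vectors_def rows_def lessThan_atLeast0)
  then have "inj_on (row F) {..<2 ^ k}"
    by (intro eq_card_imp_inj_on) (auto simp: card_sign_vectors)
  with img show ?thesis by (simp add: bij_betw_def)
qed

text \<open>Two equal columns would exclude every sign vector that differs in the two coordinates.\<close>

lemma full_factorial_col_inj:
  assumes "full_factorial k F"
  shows "inj_on (col F) {..<k}"
proof (rule inj_onI, rule ccontr)
  fix i j assume ij: "i \<in> {..<k}" "j \<in> {..<k}" "col F i = col F j" "i \<noteq> j"
  have F: "F \<in> carrier_mat (2 ^ k) k" using assms by (simp add: full_factorial_def)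
  have "vec k (\<lambda>l. if l = i then -1 else 1) \<in> row F ` {..<2 ^ k}"
    using full_factorial_row_bij[OF assms] by (simp add: bij_betw_def) (simp add: sign_vectors_def)
  then obtain r where r: "r < 2 ^ k" "row F r = vec k (\<lambda>l. if l = i then -1 else 1)" by auto
  have entry: "F $$ (r, l) = (if l = i then -1 else 1)" if "l < k" for l
    using arg_cong[OF r(2), of "\<lambda>v. v $ l"] F that r(1) by simp
  have "F $$ (r, i) = F $$ (r, j)"
    using arg_cong[OF ij(3), of "\<lambda>v. v $ r"] ij(1,2) F r(1) by simp
  then show False using ij entry[of i] entry[of j] by simp
qed

lemma full_factorial_cols:
  assumes "full_factorial k F"
  shows "set (cols F) = col F ` {..<k}" and "finite (set (cols F))" and "card (set (cols F)) = k"
proof -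
  show *: "set (cols F) = col F ` {..<k}"
    using assms by (auto simp: full_factorial_def cols_def)
  show "card (set (cols F)) = k"
    using full_factorial_col_inj[OF assms] by (simp add: * card_image)
qed simp

lemma full_factorial_index:
  assumes "full_factorial k F" and "i < k" and "r < 2 ^ k"
  shows "col F i $ r = row F r $ i"
  using assms by (auto simp: full_factorial_def)

lemma full_factorial_entry:
  assumes "full_factorial k F" and "c \<in> set (cols F)" and "r < 2 ^ k"
  shows "c $ r \<in> {1, -1}"
proof -
  obtain i where i: "i < k" "c = col F i" using assms(2) full_factorial_cols(1)[OF assms(1)] by auto
  have "row F r \<in> sign_vectors k"
    using full_factorial_row_bij[OF assms(1)] assms(3) by (auto simp: bij_betw_def)
  then show ?thesis using i full_factorial_index[OF assms(1) i(1) assms(3)]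
    by (auto simp: sign_vectors_def)
qed

lemma full_factorial_sum_prod_eq_0:
  assumes "full_factorial k F" and "W \<subseteq> set (cols F)" and "W \<noteq> {}"
  shows "(\<Sum>r<2 ^ k. \<Prod>c\<in>W. c $ r) = 0"
proof -
  obtain I where I: "I \<subseteq> {..<k}" "W = col F ` I"
    using assms(2) full_factorial_cols(1)[OF assms(1)] by (auto simp: subset_image_iff)
  have "(\<Prod>c\<in>W. c $ r) = (\<Prod>i\<in>I. row F r $ i)" if "r < 2 ^ k" for r
    using I inj_on_subset[OF full_factorial_col_inj[OF assms(1)] I(1)] that
    by (auto simp: prod.reindex intro!: prod.cong full_factorial_index[OF assms(1)])
  then have "(\<Sum>r<2 ^ k. \<Prod>c\<in>W. c $ r) = (\<Sum>r<2 ^ k. \<Prod>i\<in>I. row F r $ i)" by simp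
  also have "\<dots> = (\<Sum>v\<in>sign_vectors k. \<Prod>i\<in>I. v $ i)"
    by (rule sum.reindex_bij_betw[OF full_factorial_row_bij[OF assms(1)]])
  also have "\<dots> = 0" using I assms(3) by (intro sum_prod_sign_vectors_eq_0) auto
  finally show ?thesis .
qed

text \<open>Common factors occur squared, hence cancel: taking products turns sets of columns under
  symmetric difference into a group of sign vectors.\<close>

lemma prod_sym_diff_of_signs:
  fixes f :: "'a \<Rightarrow> int"
  assumes "finite U" and "finite V" and "\<And>x. x \<in> U \<union> V \<Longrightarrow> f x \<in> {1, -1}"
  shows "prod f U * prod f V = prod f ((U - V) \<union> (V - U))"
proof -
  have "prod f (U \<inter> V) * prod f (U \<inter> V) = (\<Prod>x\<in>U \<inter> V. f x * f x)"
    by (simp add: prod.distrib)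
  also have "\<dots> = 1" using assms(3) by (intro prod.neutral) fastforce
  finally have 1: "prod f (U \<inter> V) * prod f (U \<inter> V) = 1" .
  have U: "prod f U = prod f (U \<inter> V) * prod f (U - V)"
    using assms prod.Int_Diff by blast
  have V: "prod f V = prod f (U \<inter> V) * prod f (V - U)"
    using assms prod.Int_Diff by (metis Int_commute)
  have "prod f U * prod f V = (prod f (U \<inter> V) * prod f (U \<inter> V)) * (prod f (U - V) * prod f (V - U))"
    by (simp add: U V ac_simps)
  also have "\<dots> = prod f ((U - V) \<union> (V - U))"
    unfolding 1 using assms by (subst prod.union_disjoint) auto
  finally show ?thesis .
qed

text \<open>If two products agree then the product over the symmetric difference is constantly 1, so its
  entry sum is not 0 and the symmetric difference must be empty.\<close>

lemma full_factorial_prod_inj: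
  assumes "full_factorial k F"
  shows "inj_on (entrywise_prod (2 ^ k)) (Pow (set (cols F)))"
proof (rule inj_onI)
  fix U V
  assume UV: "U \<in> Pow (set (cols F))" "V \<in> Pow (set (cols F))"
    and eq: "entrywise_prod (2 ^ k) U = entrywise_prod (2 ^ k) V"
  define Y where "Y = (U - V) \<union> (V - U)"
  have fin: "finite U" "finite V" using UV finite_subset by auto
  have "(\<Prod>c\<in>Y. c $ r) = 1" if r: "r < 2 ^ k" for r
  proof -
    have signs: "c $ r \<in> {1, -1}" if "c \<in> U \<union> V" for c
      using that UV r full_factorial_entry[OF assms] by blast
    have "(\<Prod>c\<in>U. c $ r) = (\<Prod>c\<in>V. c $ r)"
      using arg_cong[OF eq, of "\<lambda>v. v $ r"] r by (simp add: entrywise_prod_def)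
    moreover have "(\<Prod>c\<in>U. c $ r) * (\<Prod>c\<in>U. c $ r) = 1"
      using prod_sym_diff_of_signs[of U U "\<lambda>c. c $ r"] fin signs by auto
    ultimately show ?thesis
      using prod_sym_diff_of_signs[OF fin, of "\<lambda>c. c $ r"] signs by (simp add: Y_def)
  qed
  then have "(\<Sum>r<2 ^ k. \<Prod>c\<in>Y. c $ r) = 2 ^ k" by simp
  moreover have "Y \<subseteq> set (cols F)" using UV by (auto simp: Y_def)
  ultimately have "Y = {}"
    using full_factorial_sum_prod_eq_0[OF assms, of Y] by (cases "Y = {}") simp_all
  then show "U = V" by (auto simp: Y_def)
qed

lemma saturated_design_cols:
  assumes "saturated_design k H"
  obtains F where "full_factorial k F"
    and "set (cols H) = entrywise_prod (2 ^ k) ` (Pow (set (cols F)) - {{}})"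
proof -
  obtain F where F: "full_factorial k F"
    "set (cols H) = {entrywise_prod (2 ^ k) W | W. W \<subseteq> set (cols F) \<and> W \<noteq> {}}"
    using assms unfolding saturated_design_def by blast
  show ?thesis by (rule that[OF F(1)]) (unfold F(2), auto)
qed

lemma saturated_design_card:
  assumes "saturated_design k H"
  shows "card (set (cols H)) = 2 ^ k - 1"
proof -
  obtain F where F: "full_factorial k F"
    "set (cols H) = entrywise_prod (2 ^ k) ` (Pow (set (cols F)) - {{}})"
    by (rule saturated_design_cols[OF assms])
  have "card (set (cols H)) = card (Pow (set (cols F)) - {{}})"
    unfolding F(2) using full_factorial_prod_inj[OF F(1)]
    by (intro card_image) (blast intro: inj_on_subset)
  also have "\<dots> = 2 ^ k - 1"
    using full_factorial_cols[OF F(1)] by (simp add: card_Pow)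
  finally show ?thesis .
qed

text \<open>The empty set of columns is included on purpose: products of design columns may be the
  all-ones column, which is not itself a column of the design.\<close>

lemma full_factorial_prod_closed:
  assumes "full_factorial k F" and "finite W"
    and "W \<subseteq> entrywise_prod (2 ^ k) ` Pow (set (cols F))"
  shows "entrywise_prod (2 ^ k) W \<in> entrywise_prod (2 ^ k) ` Pow (set (cols F))"
  using assms(2,3)
proof (induction W rule: finite_induct)
  case (insert c W)
  then obtain U V where U: "U \<subseteq> set (cols F)" "c = entrywise_prod (2 ^ k) U"
    and V: "V \<subseteq> set (cols F)" "entrywise_prod (2 ^ k) W = entrywise_prod (2 ^ k) V" by auto
  have fin: "finite U" "finite V" using U V finite_subset by auto
  have "entrywise_prod (2 ^ k) (insert c W) = entrywise_prod (2 ^ k) ((U - V) \<union> (V - U))"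
  proof (rule eq_vecI)
    fix r assume "r < dim_vec (entrywise_prod (2 ^ k) ((U - V) \<union> (V - U)))"
    then have r: "r < 2 ^ k" by (simp add: entrywise_prod_def)
    have "(\<Prod>c\<in>W. c $ r) = (\<Prod>c\<in>V. c $ r)"
      using arg_cong[OF V(2), of "\<lambda>v. v $ r"] r by (simp add: entrywise_prod_def)
    moreover have "c $ r = (\<Prod>c\<in>U. c $ r)" using r by (simp add: U(2) entrywise_prod_def)
    moreover have "(\<Prod>c\<in>U. c $ r) * (\<Prod>c\<in>V. c $ r) = (\<Prod>c\<in>(U - V) \<union> (V - U). c $ r)"
      using U(1) V(1) r full_factorial_entry[OF assms(1)]
      by (intro prod_sym_diff_of_signs fin) blast
    ultimately show "entrywise_prod (2 ^ k) (insert c W) $ r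
        = entrywise_prod (2 ^ k) ((U - V) \<union> (V - U)) $ r"
      using r insert.hyps by (simp add: entrywise_prod_def)
  qed (simp add: entrywise_prod_def)
  moreover have "(U - V) \<union> (V - U) \<in> Pow (set (cols F))" using U V by auto
  ultimately show ?case by blast
qed (auto simp: image_iff)

text \<open>The product over \<open>W\<close> is also a product of columns of the factorial, and only the empty one of
  these has an entry sum other than 0.  This orthogonality is what turns
  word counting into an average over the runs.\<close>

lemma saturated_design_word_sum:
  assumes "saturated_design k H" and "W \<subseteq> set (cols H)"
  shows "(\<Sum>r<2 ^ k. \<Prod>c\<in>W. c $ r)
    = (if entrywise_prod (2 ^ k) W = ones_vec (2 ^ k) then 2 ^ k else 0)"
proof -
  obtain F where F: "full_factorial k F"
    "set (cols H) = entrywise_prod (2 ^ k) ` (Pow (set (cols F)) - {{}})"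
    by (rule saturated_design_cols[OF assms(1)])
  have "finite W" using assms(2) finite_subset by auto
  then have "entrywise_prod (2 ^ k) W \<in> entrywise_prod (2 ^ k) ` Pow (set (cols F))"
    using assms(2) F(2) by (intro full_factorial_prod_closed[OF F(1)]) auto
  then obtain U where U: "U \<subseteq> set (cols F)"
    "entrywise_prod (2 ^ k) W = entrywise_prod (2 ^ k) U" by auto
  have WU: "(\<Prod>c\<in>W. c $ r) = (\<Prod>c\<in>U. c $ r)" if "r < 2 ^ k" for r
    using arg_cong[OF U(2), of "\<lambda>v. v $ r"] that by (simp add: entrywise_prod_def)
  show ?thesis
  proof (cases "entrywise_prod (2 ^ k) W = ones_vec (2 ^ k)")
    case True
    have "(\<Prod>c\<in>W. c $ r) = 1" if "r < 2 ^ k" for r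
      using arg_cong[OF True, of "\<lambda>v. v $ r"] that by (simp add: entrywise_prod_def)
    then show ?thesis using True by simp
  next
    case False
    then have "U \<noteq> {}" using U(2) by (auto simp: entrywise_prod_def)
    then show ?thesis
      using False full_factorial_sum_prod_eq_0[OF F(1) U(1)] by (simp add: WU)
  qed
qed

lemma saturated_design_entry:
  assumes "saturated_design k H" and "c \<in> set (cols H)" and "r < 2 ^ k"
  shows "c $ r \<in> {1, -1}"
proof -
  obtain F where F: "full_factorial k F"
    "set (cols H) = entrywise_prod (2 ^ k) ` (Pow (set (cols F)) - {{}})"
    by (rule saturated_design_cols[OF assms(1)])
  obtain U where U: "U \<subseteq> set (cols F)" "c = entrywise_prod (2 ^ k) U"
    using assms(2) F(2) by auto
  have "(\<Prod>c\<in>U. c $ r) * (\<Prod>c\<in>U. c $ r) = 1"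
    using U(1) assms(3) full_factorial_entry[OF F(1)] finite_subset[OF U(1)]
      prod_sym_diff_of_signs[of U U "\<lambda>c. c $ r"] by fastforce
  then show ?thesis using U(2) assms(3) by (auto simp: entrywise_prod_def zmult_eq_1_iff)
qed

text \<open>In terms of the factorial, the entry sum of a run over all products, the empty one included,
  is \<open>\<Prod>c. (c $ r + 1)\<close>, which vanishes as soon as one factor has level \<open>-1\<close>.  Removing the empty
  product leaves \<open>-1\<close>.\<close>

lemma saturated_design_row_sums:
  assumes "saturated_design k H"
  obtains r0 where "r0 < 2 ^ k" and "\<And>c. c \<in> set (cols H) \<Longrightarrow> c $ r0 = 1"
    and "\<And>r. r < 2 ^ k \<Longrightarrow> r \<noteq> r0 \<Longrightarrow> (\<Sum>c\<in>set (cols H). c $ r) = -1"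
proof -
  obtain F where F: "full_factorial k F"
    "set (cols H) = entrywise_prod (2 ^ k) ` (Pow (set (cols F)) - {{}})"
    by (rule saturated_design_cols[OF assms])
  have bij: "bij_betw (row F) {..<2 ^ k} (sign_vectors k)" by (rule full_factorial_row_bij[OF F(1)])
  have "ones_vec k \<in> row F ` {..<2 ^ k}"
    using bij by (simp add: bij_betw_def) (simp add: sign_vectors_def)
  then obtain r0 where r0: "r0 < 2 ^ k" "row F r0 = ones_vec k" by auto
  have one: "c $ r0 = 1" if "c \<in> set (cols F)" for c
    using that r0 full_factorial_index[OF F(1)] full_factorial_cols(1)[OF F(1)] by auto
  show ?thesis
  proof (rule that[OF r0(1)])
    fix c assume "c \<in> set (cols H)"
    then obtain U where "U \<subseteq> set (cols F)" "c = entrywise_prod (2 ^ k) U"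
      using F(2) by auto
    then show "c $ r0 = 1" using r0(1) one by (auto simp: entrywise_prod_def intro!: prod.neutral)
  next
    fix r :: nat assume r: "r < 2 ^ k" "r \<noteq> r0"
    have "\<exists>i<k. row F r $ i = -1"
    proof (rule ccontr)
      assume neg: "\<not> (\<exists>i<k. row F r $ i = -1)"
      have "row F r \<in> sign_vectors k" using bij r by (auto simp: bij_betw_def)
      then have "row F r \<in> carrier_vec k" and "\<And>i. i < k \<Longrightarrow> row F r $ i \<in> {1, -1}"
        by (simp_all add: sign_vectors_def del: row_carrier_vec)
      then have "row F r = ones_vec k"
        using neg by (metis carrier_vecD dim_vec eq_vecI index_vec insertE singletonD)
      then show False using bij r r0 by (metis bij_betw_def inj_onD lessThan_iff)
    qed
    then obtain i where i: "i < k" "row F r $ i = -1" by blast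
    have "(\<Prod>c\<in>set (cols F). c $ r + 1) = 0"
      using i r full_factorial_index[OF F(1) i(1) r(1)] full_factorial_cols(1)[OF F(1)]
      by (auto intro!: bexI[of _ i])
    then have "(\<Sum>U\<in>Pow (set (cols F)). \<Prod>c\<in>U. c $ r) = 0"
      by (simp add: prod_add)
    then have *: "(\<Sum>U\<in>Pow (set (cols F)) - {{}}. \<Prod>c\<in>U. c $ r) = -1"
      by (subst (asm) sum.remove[of _ "{}"]) auto
    have "(\<Sum>c\<in>set (cols H). c $ r)
        = (\<Sum>U\<in>Pow (set (cols F)) - {{}}. entrywise_prod (2 ^ k) U $ r)"
      unfolding F(2) by (subst sum.reindex)
        (auto intro: inj_on_subset[OF full_factorial_prod_inj[OF F(1)]])
    also have "\<dots> = -1" using * r by (simp add: entrywise_prod_def)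
    finally show "(\<Sum>c\<in>set (cols H). c $ r) = -1" .
  qed
qed

text \<open>No design column is the all-ones column, since the product determines the set of factorial
  columns, and two columns whose product is the all-ones column agree.  Hence the coefficients
  with index 1 and 2 may be set to 0.\<close>

lemma saturated_design_no_short_words:
  assumes "saturated_design k H" and "D \<subseteq> set (cols H)" and "i = 1 \<or> i = 2"
  shows "A_words (2 ^ k) D i = 0"
proof -
  obtain F where F: "full_factorial k F"
    "set (cols H) = entrywise_prod (2 ^ k) ` (Pow (set (cols F)) - {{}})"
    by (rule saturated_design_cols[OF assms(1)])
  have no_ones: "ones_vec (2 ^ k) \<notin> set (cols H)"
  proof
    assume "ones_vec (2 ^ k) \<in> set (cols H)"
    then obtain U where U: "U \<subseteq> set (cols F)" "U \<noteq> {}"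
      "ones_vec (2 ^ k) = entrywise_prod (2 ^ k) U"
      unfolding F(2) by blast
    have "entrywise_prod (2 ^ k) U = entrywise_prod (2 ^ k) {}"
      unfolding U(3)[symmetric] by (simp add: entrywise_prod_def)
    then have "U = {}" using U(1) full_factorial_prod_inj[OF F(1)]
      by (meson Pow_iff empty_subsetI inj_onD)
    then show False using U(2) by simp
  qed
  have dim: "dim_vec c = 2 ^ k" if "c \<in> set (cols H)" for c
    using that F(2) by (auto simp: entrywise_prod_def)
  have False if W: "W \<in> defining_words (2 ^ k) D i" for W
  proof -
    have W': "W \<subseteq> set (cols H)" "card W = i" "entrywise_prod (2 ^ k) W = ones_vec (2 ^ k)"
      using W assms(2) by (auto simp: defining_words_def)
    have one: "(\<Prod>c\<in>W. c $ r) = 1" if "r < 2 ^ k" for r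
      using arg_cong[OF W'(3), of "\<lambda>v. v $ r"] that by (simp add: entrywise_prod_def)
    show False using assms(3)
    proof
      assume "i = 1"
      then obtain c where c: "W = {c}" using W'(2) card_1_singletonE by metis
      then have "c = ones_vec (2 ^ k)" using one dim W'(1) by (intro eq_vecI) auto
      then show False using no_ones c W'(1) by auto
    next
      assume "i = 2"
      then obtain c d where cd: "W = {c, d}" "c \<noteq> d" using W'(2) by (auto simp: card_2_iff)
      have "c $ r = d $ r" if "r < 2 ^ k" for r
        using one[OF that] cd by (auto simp: zmult_eq_1_iff)
      then have "c = d" using dim W'(1) cd(1) by (intro eq_vecI) auto
      then show False using cd(2) by simp
    qed
  qed
  then have "defining_words (2 ^ k) D i = {}" by blast
  then show ?thesis by (simp add: A_words_def)
qed

section \<open>Word enumerators as power series\<close>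

abbreviation fps_negate :: "real fps \<Rightarrow> real fps" where
  "fps_negate f \<equiv> f oo - fps_X"

text \<open>The substitution \<open>X \<mapsto> -X\<close> exchanges \<open>(1 + X)\<^sup>a\<close> and \<open>(1 - X)\<^sup>a\<close>; with it, all powers below are
  expressed by \<open>fps_binomial\<close>, which allows negative exponents.\<close>

lemma fps_negate_nth: "fps_nth (fps_negate f) n = (-1) ^ n * fps_nth f n"
  by (simp add: fps_compose_uminus')

lemma fps_negate_mult: "fps_negate (f * g) = fps_negate f * fps_negate g"
  by (rule fps_compose_mult_distrib) simp

lemma fps_negate_negate: "fps_negate (fps_negate f) = f"
  by (rule fps_ext) (simp add: fps_negate_nth flip: mult.assoc power_add mult_2)

lemma krawtchouk_eq_coeff:
  "krawtchouk j x m = fps_nth (fps_binomial (of_int (m - x)) * fps_negate (fps_binomial (of_int x))) j"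
  by (subst mult.commute) (simp add: krawtchouk_def fps_mult_nth fps_negate_nth)

text \<open>This is \<open>(1 + X)\<^sup>M (1 - X)\<^sup>M = (1 - X\<^sup>2)\<^sup>M\<close> for an integer \<open>M\<close>, possibly negative.  Both sides
  turn sums of exponents into products and agree at exponent 1, hence at all integers.\<close>

lemma fps_binomial_square_compose:
  "fps_binomial (of_int M :: real) * fps_negate (fps_binomial (of_int M))
     = fps_binomial (of_int M) oo - (fps_X ^ 2)"
proof -
  define e :: "real \<Rightarrow> real fps" where "e a = fps_binomial a * fps_negate (fps_binomial a)" for a
  define t :: "real \<Rightarrow> real fps" where "t a = fps_binomial a oo - (fps_X ^ 2)" for a
  have e_add: "e (a + b) = e a * e b" for a b
    by (simp add: e_def fps_binomial_add_mult fps_negate_mult ac_simps)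
  have t_add: "t (a + b) = t a * t b" for a b
    unfolding t_def fps_binomial_add_mult by (rule fps_compose_mult_distrib) simp
  have e0: "e 0 = 1" and t0: "t 0 = 1" by (simp_all add: e_def t_def)
  have one: "e 1 = t 1"
    by (simp add: e_def t_def fps_binomial_1 fps_compose_add_distrib power2_eq_square algebra_simps)
  have nat: "e (real n) = t (real n)" for n
    by (induction n) (simp_all add: e0 t0 one e_add t_add)
  have "e (of_int M) = t (of_int M)"
  proof (cases "M \<ge> 0")
    case True
    then show ?thesis using nat[of "nat M"] by simp
  next
    case False
    then have M: "real (nat (- M)) = - of_int M" by simp
    have "e (of_int M) * e (- of_int M) = 1" "t (of_int M) * t (- of_int M) = 1"
      by (simp_all add: e0 t0 flip: e_add t_add)
    moreover have "e (- of_int M) = t (- of_int M)" using nat[of "nat (- M)"] M by simp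
    ultimately show ?thesis by (metis mult.commute mult.left_commute mult.right_neutral)
  qed
  then show ?thesis by (simp add: e_def t_def)
qed

lemma fps_compose_neg_square_nth:
  fixes f :: "real fps"
  shows "fps_nth (f oo - (fps_X ^ 2)) n = (if even n then (-1) ^ (n div 2) * fps_nth f (n div 2) else 0)"
proof -
  have pow: "fps_nth ((- (fps_X ^ 2)) ^ i) n = (if n = 2 * i then (-1) ^ i else (0 :: real))" for i
  proof -
    have "(- (fps_X ^ 2)) ^ i = fps_const ((-1) ^ i) * (fps_X :: real fps) ^ (2 * i)"
      by (subst power_minus) (simp add: power_mult fps_const_power[symmetric] flip: fps_const_neg)
    then show ?thesis by simp
  qed
  have "fps_nth (f oo - (fps_X ^ 2)) n
      = (\<Sum>i=0..n. if n = 2 * i then (-1) ^ (n div 2) * fps_nth f (n div 2) else 0)"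
    unfolding fps_compose_nth pow by (intro sum.cong) auto
  also have "\<dots> = (\<Sum>i=0..n. if i = n div 2
      then (if even n then (-1) ^ (n div 2) * fps_nth f (n div 2) else 0) else 0)"
    by (intro sum.cong) auto
  finally show ?thesis by simp
qed

text \<open>The series is \<open>(1 - X) (1 - X\<^sup>2)\<^sup>M\<close>; its coefficients are, up to a sign \<open>(-1) ^ i\<close>, the
  binomial terms of \<open>c_coeff\<close> with \<open>n = j - i\<close>.\<close>

lemma complement_factor_nth:
  "fps_nth (fps_binomial (of_int M :: real) * fps_negate (fps_binomial (of_int M + 1))) n
     = (-1) ^ (n - n div 2) * (of_int M gchoose (n div 2))"
proof -
  have "fps_binomial (of_int M :: real) * fps_negate (fps_binomial (of_int M + 1))
      = (fps_binomial (of_int M) oo - (fps_X ^ 2)) * (1 - fps_X)"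
    by (simp add: fps_binomial_add_mult fps_negate_mult fps_binomial_1 fps_compose_add_distrib
        fps_binomial_square_compose mult.assoc[symmetric])
  then have *: "fps_nth (fps_binomial (of_int M :: real) * fps_negate (fps_binomial (of_int M + 1))) n
      = fps_nth (fps_binomial (of_int M) oo - (fps_X ^ 2)) n
        - (if n = 0 then 0 else fps_nth (fps_binomial (of_int M) oo - (fps_X ^ 2)) (n - 1))"
    by (simp add: right_diff_distrib)
  show ?thesis
  proof (cases "even n")
    case True
    then obtain q where "n = 2 * q" by blast
    then show ?thesis unfolding * by (auto simp: fps_compose_neg_square_nth)
  next
    case False
    then obtain q where q: "n = 2 * q + 1" by (metis oddE)
    have "n - n div 2 = Suc q" using q by simp
    then show ?thesis unfolding * using q by (simp add: fps_compose_neg_square_nth)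
  qed
qed

definition word_series :: "nat \<Rightarrow> int vec set \<Rightarrow> real fps" where
  "word_series n D = Abs_fps (\<lambda>i. real (A_words n D i))"

definition row_series :: "int vec set \<Rightarrow> nat \<Rightarrow> real fps" where
  "row_series D r = (\<Prod>c\<in>D. 1 + fps_const (of_int (c $ r)) * fps_X)"

lemma row_series_nth:
  assumes "finite D"
  shows "fps_nth (row_series D r) i = (\<Sum>W | W \<subseteq> D \<and> card W = i. of_int (\<Prod>c\<in>W. c $ r))"
proof -
  have const: "(\<Prod>c\<in>W. fps_const (of_int (c $ r))) = fps_const (of_int (\<Prod>c\<in>W. c $ r) :: real)"
    for W :: "int vec set"
    by (induction W rule: infinite_finite_induct) simp_all
  have "row_series D r = (\<Sum>W\<in>Pow D. \<Prod>c\<in>W. fps_const (of_int (c $ r)) * fps_X)"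
    unfolding row_series_def using prod_add[OF assms, of "\<lambda>c. fps_const (of_int (c $ r)) * fps_X" "\<lambda>_. 1"]
    by (simp add: add.commute)
  also have "\<dots> = (\<Sum>W\<in>Pow D. fps_const (of_int (\<Prod>c\<in>W. c $ r)) * fps_X ^ card W)"
    by (simp add: prod.distrib const)
  finally have "fps_nth (row_series D r) i
      = (\<Sum>W\<in>Pow D. if i = card W then of_int (\<Prod>c\<in>W. c $ r) else 0)"
    by (simp add: fps_sum_nth if_distrib cong: if_cong)
  also have "\<dots> = (\<Sum>W | W \<subseteq> D \<and> card W = i. of_int (\<Prod>c\<in>W. c $ r))"
    using assms by (intro sum.mono_neutral_cong_right) auto
  finally show ?thesis .
qed

lemma sum_row_series:
  assumes "saturated_design k H" and "D \<subseteq> set (cols H)"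
  shows "(\<Sum>r<2 ^ k. row_series D r) = 2 ^ k * word_series (2 ^ k) D"
proof (rule fps_ext)
  fix i
  have fin: "finite D" using assms(2) finite_subset by auto
  have eq: "{W. W \<subseteq> D \<and> card W = i} \<inter> {W. entrywise_prod (2 ^ k) W = ones_vec (2 ^ k)}
      = defining_words (2 ^ k) D i"
    using finite_subset[OF _ fin] by (auto simp: defining_words_def)
  have "fps_nth (\<Sum>r<2 ^ k. row_series D r) i
      = (\<Sum>W | W \<subseteq> D \<and> card W = i. of_int (\<Sum>r<2 ^ k. \<Prod>c\<in>W. c $ r))"
    unfolding fps_sum_nth row_series_nth[OF fin] of_int_sum by (rule sum.swap)
  also have "\<dots> = (\<Sum>W | W \<subseteq> D \<and> card W = i.
      if entrywise_prod (2 ^ k) W = ones_vec (2 ^ k) then 2 ^ k else 0)"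
    using assms(2) by (intro sum.cong refl, subst saturated_design_word_sum[OF assms(1)]) auto
  also have "\<dots> = 2 ^ k * real (A_words (2 ^ k) D i)"
    using fin by (simp add: sum.If_cases eq A_words_def)
  also have "\<dots> = fps_nth (2 ^ k * word_series (2 ^ k) D) i"
  proof -
    have "(2 ^ k :: real fps) = fps_const (2 ^ k)"
      by (simp add: fps_numeral_fps_const flip: fps_const_power)
    then show ?thesis by (simp add: word_series_def)
  qed
  finally show "fps_nth (\<Sum>r<2 ^ k. row_series D r) i = fps_nth (2 ^ k * word_series (2 ^ k) D) i" .
qed

lemma row_series_eq_binomials:
  assumes "finite D" and "\<And>c. c \<in> D \<Longrightarrow> c $ r \<in> {1, -1}"
  shows "row_series D r = fps_binomial (real (card {c \<in> D. c $ r = 1}))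
    * fps_negate (fps_binomial (real (card {c \<in> D. c $ r = -1})))"
proof -
  have D: "D = {c \<in> D. c $ r = 1} \<union> {c \<in> D. c $ r = -1}" using assms(2) by auto
  have "row_series D r = (\<Prod>c\<in>{c \<in> D. c $ r = 1}. 1 + fps_const (of_int (c $ r)) * fps_X)
      * (\<Prod>c\<in>{c \<in> D. c $ r = -1}. 1 + fps_const (of_int (c $ r)) * fps_X)"
    unfolding row_series_def using assms(1) by (subst D, subst prod.union_disjoint) auto
  also have "\<dots> = (1 + fps_X) ^ card {c \<in> D. c $ r = 1} * (1 - fps_X) ^ card {c \<in> D. c $ r = -1}"
    by (simp flip: fps_const_neg)
  finally show ?thesis
    by (simp add: fps_binomial_of_nat fps_compose_add_distrib flip: fps_compose_power)
qed

lemma signs_card_sum: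
  fixes f :: "'a \<Rightarrow> int"
  assumes "finite D" and "\<And>c. c \<in> D \<Longrightarrow> f c \<in> {1, -1}"
  shows "int (card D) = int (card {c \<in> D. f c = 1}) + int (card {c \<in> D. f c = -1})"
    and "(\<Sum>c\<in>D. f c) = int (card {c \<in> D. f c = 1}) - int (card {c \<in> D. f c = -1})"
proof -
  have D: "D = {c \<in> D. f c = 1} \<union> {c \<in> D. f c = -1}" using assms(2) by auto
  show "int (card D) = int (card {c \<in> D. f c = 1}) + int (card {c \<in> D. f c = -1})"
    using assms(1) by (subst D, subst card_Un_disjoint) auto
  show "(\<Sum>c\<in>D. f c) = int (card {c \<in> D. f c = 1}) - int (card {c \<in> D. f c = -1})"
    using assms(1) by (subst (1) D, subst sum.union_disjoint) auto
qed

lemma saturated_design_complement_card: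
  assumes "saturated_design k H" and "1 \<le> k" and "D \<union> D' = set (cols H)" and "D \<inter> D' = {}"
  shows "int (card D) - 2 ^ (k - 1) + 1 + int (card D') = 2 ^ (k - 1)"
proof -
  have fin: "finite D" "finite D'" using assms(3) by (metis List.finite_set finite_Un)+
  have "card D + card D' = 2 ^ k - 1"
    using card_Un_disjoint[OF fin assms(4)] assms(3) saturated_design_card[OF assms(1)] by simp
  then have "card D + card D' + 1 = 2 ^ k" by simp
  then have "int (card D + card D' + 1) = int (2 ^ k)" by (rule arg_cong)
  then have "int (card D) + int (card D') = 2 ^ k - 1" by simp
  moreover have "(2 :: int) ^ k = 2 * 2 ^ (k - 1)"
    using assms(2) by (metis Suc_diff_1 Suc_le_lessD One_nat_def power_Suc)
  ultimately show ?thesis by linarith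
qed

text \<open>If the run has \<open>a\<close> ones in \<open>D\<close> and \<open>b\<close> minus ones, and \<open>a'\<close> and \<open>b'\<close> of them in \<open>D'\<close>, then
  \<open>a = M + b'\<close> and \<open>b = M + 1 + a'\<close>.  The substitution of \<open>-X\<close> exchanges the roles of the two signs.\<close>

lemma row_series_complement:
  assumes "saturated_design k H" and "1 \<le> k" and "D \<union> D' = set (cols H)" and "D \<inter> D' = {}"
    and "r < 2 ^ k" and "(\<Sum>c\<in>set (cols H). c $ r) = -1"
  defines "M \<equiv> int (card D) - 2 ^ (k - 1)"
  shows "row_series D r = fps_binomial (of_int M) * fps_negate (fps_binomial (of_int M + 1))
    * fps_negate (row_series D' r)"
proof -
  have fin: "finite D" "finite D'" using assms(3) by (metis List.finite_set finite_Un)+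
  have entry: "c $ r \<in> {1, -1}" if "c \<in> D \<union> D'" for c
    using that assms(3) saturated_design_entry[OF assms(1) _ assms(5)] by blast
  define a b a' b' where "a = card {c \<in> D. c $ r = 1}" and "b = card {c \<in> D. c $ r = -1}"
    and "a' = card {c \<in> D'. c $ r = 1}" and "b' = card {c \<in> D'. c $ r = -1}"
  have "M + 1 + int (card D') = 2 ^ (k - 1)"
    unfolding M_def by (rule saturated_design_complement_card[OF assms(1-4)])
  moreover have "(\<Sum>c\<in>D. c $ r) + (\<Sum>c\<in>D'. c $ r) = -1"
    using assms(3,6) sum.union_disjoint[OF fin assms(4), of "\<lambda>c. c $ r"] by simp
  ultimately have nums: "M + int b' = int a" "M + 1 + int a' = int b"
    using signs_card_sum[OF fin(1), of "\<lambda>c. c $ r"] signs_card_sum[OF fin(2), of "\<lambda>c. c $ r"] entry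
    unfolding M_def a_def b_def a'_def b'_def by auto
  have reals: "of_int M + real b' = real a" "of_int M + 1 + real a' = real b"
    using arg_cong[OF nums(1), of real_of_int] arg_cong[OF nums(2), of real_of_int] by simp_all
  have D: "row_series D r = fps_binomial (real a) * fps_negate (fps_binomial (real b))"
    unfolding a_def b_def using entry fin by (intro row_series_eq_binomials) auto
  have D': "row_series D' r = fps_binomial (real a') * fps_negate (fps_binomial (real b'))"
    unfolding a'_def b'_def using entry fin by (intro row_series_eq_binomials) auto
  have "fps_binomial (of_int M) * fps_negate (fps_binomial (of_int M + 1)) * fps_negate (row_series D' r)
      = (fps_binomial (of_int M) * fps_binomial (real b'))
        * fps_negate (fps_binomial (of_int M + 1) * fps_binomial (real a'))"
    unfolding D' by (simp add: fps_negate_mult fps_negate_negate ac_simps)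
  also have "\<dots> = row_series D r"
    by (simp only: D reals flip: fps_binomial_add_mult)
  finally show ?thesis by simp
qed

text \<open>The last summand is the correction at the run of ones, where the relation of
  \<open>row_series_complement\<close> fails.\<close>

lemma word_series_complement:
  assumes "saturated_design k H" and "1 \<le> k" and "D \<union> D' = set (cols H)" and "D \<inter> D' = {}"
  defines "M \<equiv> int (card D) - 2 ^ (k - 1)"
  shows "2 ^ k * word_series (2 ^ k) D
    = fps_binomial (of_int M) * fps_negate (fps_binomial (of_int M + 1))
        * fps_negate (2 ^ k * word_series (2 ^ k) D')
      + (fps_binomial (real (card D))
         - fps_binomial (of_int M) * fps_negate (fps_binomial (2 ^ (k - 1))))"
proof -
  define g where "g = fps_binomial (of_int M) * fps_negate (fps_binomial (of_int M + 1))"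
  have fin: "finite D" "finite D'" using assms(3) by (metis List.finite_set finite_Un)+
  have sub: "D \<subseteq> set (cols H)" "D' \<subseteq> set (cols H)" using assms(3) by blast+
  obtain r0 where r0: "r0 < 2 ^ k" "\<And>c. c \<in> set (cols H) \<Longrightarrow> c $ r0 = 1"
    and other: "\<And>r. r < 2 ^ k \<Longrightarrow> r \<noteq> r0 \<Longrightarrow> (\<Sum>c\<in>set (cols H). c $ r) = -1"
    using saturated_design_row_sums[OF assms(1)] by blast
  have "M + 1 + int (card D') = 2 ^ (k - 1)"
    unfolding M_def by (rule saturated_design_complement_card[OF assms(1-4)])
  then have "real_of_int (M + 1 + int (card D')) = real_of_int (2 ^ (k - 1))" by (rule arg_cong)
  then have num: "of_int M + 1 + real (card D') = 2 ^ (k - 1)" by simp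
  have r0_series: "row_series X r0 = fps_binomial (real (card X))" if "X \<subseteq> set (cols H)" for X
  proof -
    have "row_series X r0 = (\<Prod>c\<in>X. 1 + fps_X)"
      unfolding row_series_def using r0(2) that by (intro prod.cong) auto
    then show ?thesis by (simp add: fps_binomial_of_nat)
  qed
  have D'_series: "row_series D' r0 = fps_binomial (real (card D'))"
    by (rule r0_series[OF sub(2)])
  have "g * fps_negate (row_series D' r0)
      = fps_binomial (of_int M) * fps_negate (fps_binomial (2 ^ (k - 1)))"
    by (simp only: g_def D'_series mult.assoc num flip: fps_negate_mult fps_binomial_add_mult)
  then have split0: "row_series D r0 = g * fps_negate (row_series D' r0) + (fps_binomial (real (card D))
         - fps_binomial (of_int M) * fps_negate (fps_binomial (2 ^ (k - 1))))"
    using r0_series[OF sub(1)] by simp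
  have split: "row_series D r = g * fps_negate (row_series D' r)" if "r < 2 ^ k" "r \<noteq> r0" for r
    unfolding g_def M_def using that by (intro row_series_complement[OF assms(1-4)] other)
  have "2 ^ k * word_series (2 ^ k) D = (\<Sum>r<2 ^ k. row_series D r)"
    by (rule sum_row_series[OF assms(1) sub(1), symmetric])
  also have "\<dots> = (\<Sum>r<2 ^ k. g * fps_negate (row_series D' r) + (if r = r0
      then fps_binomial (real (card D))
         - fps_binomial (of_int M) * fps_negate (fps_binomial (2 ^ (k - 1))) else 0))"
    by (intro sum.cong) (auto simp: split split0)
  also have "\<dots> = g * fps_negate (\<Sum>r<2 ^ k. row_series D' r) + (fps_binomial (real (card D))
         - fps_binomial (of_int M) * fps_negate (fps_binomial (2 ^ (k - 1))))"
    using r0(1) by (simp add: sum.distrib sum_distrib_left fps_compose_sum_distrib)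
  also have "(\<Sum>r<2 ^ k. row_series D' r) = 2 ^ k * word_series (2 ^ k) D'"
    by (rule sum_row_series[OF assms(1) sub(2)])
  finally show ?thesis by (simp add: g_def)
qed

text \<open>The coefficient of \<open>X ^ j\<close> in \<open>word_series_complement\<close>, divided by \<open>2 ^ k\<close>: the word count with
  index \<open>i\<close> meets the coefficient \<open>j - i\<close> of the common factor, and the correction term gives the
  Krawtchouk polynomials.\<close>

lemma A_words_complement:
  assumes "saturated_design k H" and "1 \<le> k" and "D \<union> D' = set (cols H)" and "D \<inter> D' = {}"
  shows "real (A_words (2 ^ k) D j)
    = (\<Sum>i=0..j. c_coeff k (int (card D)) i j * real (A_words (2 ^ k) D' i))"
proof -
  define M where "M = int (card D) - 2 ^ (k - 1)"
  define g where "g = fps_binomial (of_int M :: real) * fps_negate (fps_binomial (of_int M + 1))"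
  define K where "K = (krawtchouk j 0 (int (card D)) - krawtchouk j (2 ^ (k - 1)) (int (card D))) / 2 ^ k"
  have c: "c_coeff k (int (card D)) i j * real (A_words (2 ^ k) D' i)
      = (if i = 0 then K else 0) + fps_nth g (j - i) * ((-1) ^ i * real (A_words (2 ^ k) D' i))"
    if i: "i \<le> j" for i
  proof -
    \<comment> \<open>The coefficient of the series need not vanish for \<open>i = 1, 2\<close>, but the word count does.\<close>
    have short: "A_words (2 ^ k) D' i = 0" if "i = 1 \<or> i = 2"
      using saturated_design_no_short_words[OF assms(1) _ that] assms(3) by auto
    have "(-1 :: real) ^ (j - i - (j - i) div 2) * (-1) ^ i = (-1) ^ (j - (j - i) div 2)"
      using i by (auto simp flip: power_add intro!: arg_cong[of _ _ "power (-1)"])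
    then show ?thesis
      using short unfolding g_def complement_factor_nth
      by (auto simp: c_coeff_def K_def M_def A_words_0 algebra_simps)
  qed
  have pow: "(2 ^ k :: real fps) = fps_const (2 ^ k)"
    by (simp add: fps_numeral_fps_const flip: fps_const_power)
  have neg: "fps_nth (fps_negate (2 ^ k * word_series (2 ^ k) D')) i
      = 2 ^ k * ((-1) ^ i * real (A_words (2 ^ k) D' i))" for i
    by (simp add: fps_negate_nth pow word_series_def)
  have K: "fps_nth (fps_binomial (real (card D))
      - fps_binomial (of_int M) * fps_negate (fps_binomial (2 ^ (k - 1)))) j = 2 ^ k * K"
    by (simp add: K_def krawtchouk_eq_coeff M_def)
  have "2 ^ k * real (A_words (2 ^ k) D j) = fps_nth (2 ^ k * word_series (2 ^ k) D) j"
    by (simp add: pow word_series_def)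
  also have "\<dots> = fps_nth (fps_negate (2 ^ k * word_series (2 ^ k) D') * g) j + 2 ^ k * K"
    unfolding word_series_complement[OF assms] fps_add_nth
    by (simp only: K flip: M_def g_def) (simp add: mult.commute)
  also have "fps_nth (fps_negate (2 ^ k * word_series (2 ^ k) D') * g) j
      = 2 ^ k * (\<Sum>i=0..j. fps_nth g (j - i) * ((-1) ^ i * real (A_words (2 ^ k) D' i)))"
    unfolding fps_mult_nth neg by (simp add: sum_distrib_left ac_simps)
  also have "\<dots> + 2 ^ k * K
      = 2 ^ k * (\<Sum>i=0..j. (if i = 0 then K else 0)
          + fps_nth g (j - i) * ((-1) ^ i * real (A_words (2 ^ k) D' i)))"
    by (simp add: sum.distrib algebra_simps)
  also have "\<dots> = 2 ^ k * (\<Sum>i=0..j. c_coeff k (int (card D)) i j * real (A_words (2 ^ k) D' i))"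
    by (simp add: c)
  finally show ?thesis by simp
qed

section \<open>Words with one letter in a second set of columns\<close>

lemma finite_defining_words: "finite D \<Longrightarrow> finite (defining_words n D i)"
  by (rule finite_subset[of _ "Pow D"]) (auto simp: defining_words_def)

text \<open>The words are sorted by their only letter in \<open>D2\<close>.\<close>

lemma B_words_eq_sum_A_words:
  assumes "finite D1" and "finite D2" and "D1 \<inter> D2 = {}"
  shows "real (B_words n D1 D2 j)
    = (\<Sum>d\<in>D2. real (A_words n (insert d D1) (j + 1)) - real (A_words n D1 (j + 1)))"
proof -
  define X where "X d = defining_words n (insert d D1) (j + 1) - defining_words n D1 (j + 1)" for d
  have X_iff: "W \<in> X d \<longleftrightarrow> W \<in> defining_words n (insert d D1) (j + 1) \<and> d \<in> W"
    if "d \<in> D2" for W d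
    using that assms(3) by (auto simp: X_def defining_words_def)
  have "{W \<in> defining_words n (D1 \<union> D2) (j + 1). card (W \<inter> D1) = j \<and> card (W \<inter> D2) = 1}
      = (\<Union>d\<in>D2. X d)" (is "?L = ?R")
  proof (intro equalityI subsetI)
    fix W assume W: "W \<in> ?L"
    then obtain d where d: "W \<inter> D2 = {d}" by (auto simp: card_1_singleton_iff)
    then have "d \<in> D2" "d \<in> W" "W \<subseteq> insert d D1" using W by (auto simp: defining_words_def)
    then show "W \<in> ?R" using W X_iff by (auto simp: defining_words_def)
  next
    fix W assume "W \<in> ?R"
    then obtain d where d: "d \<in> D2" "W \<in> defining_words n (insert d D1) (j + 1)" "d \<in> W"
      using X_iff by auto
    then have "W \<inter> D2 = {d}" "W \<inter> D1 = W - {d}" "finite W" "card W = j + 1"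
      using assms(3) by (auto simp: defining_words_def)
    then show "W \<in> ?L" using d by (auto simp: defining_words_def)
  qed
  then have "B_words n D1 D2 j = card (\<Union>d\<in>D2. X d)" by (simp add: B_words_def)
  also have "\<dots> = (\<Sum>d\<in>D2. card (X d))"
  proof (rule card_UN_disjoint[OF assms(2)])
    show "\<forall>d\<in>D2. finite (X d)" using assms(1) by (simp add: X_def finite_defining_words)
    show "\<forall>d\<in>D2. \<forall>e\<in>D2. d \<noteq> e \<longrightarrow> X d \<inter> X e = {}"
    proof (intro ballI impI)
      fix d e assume de: "d \<in> D2" "e \<in> D2" "d \<noteq> e"
      have "e \<notin> W" if "W \<in> X d" for W
        using that de assms(3) by (auto simp: X_def defining_words_def)
      then show "X d \<inter> X e = {}" using X_iff[OF de(2)] by blast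
    qed
  qed
  also have "real \<dots> = (\<Sum>d\<in>D2. real (card (X d)))" by simp
  also have "\<dots> = (\<Sum>d\<in>D2. real (A_words n (insert d D1) (j + 1)) - real (A_words n D1 (j + 1)))"
  proof (rule sum.cong[OF refl])
    fix d assume "d \<in> D2"
    have sub: "defining_words n D1 (j + 1) \<subseteq> defining_words n (insert d D1) (j + 1)"
      by (auto simp: defining_words_def)
    then have "card (defining_words n D1 (j + 1)) \<le> card (defining_words n (insert d D1) (j + 1))"
      using assms(1) by (intro card_mono finite_defining_words) auto
    then show "real (card (X d)) = real (A_words n (insert d D1) (j + 1)) - real (A_words n D1 (j + 1))"
      using sub assms(1) by (simp add: X_def A_words_def card_Diff_subset finite_defining_words of_nat_diff)
  qed
  finally show ?thesis .
qed

lemma E_words_eq_sum_card: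
  assumes "finite (D2 \<union> D3)"
  shows "E_words n D2 D3 i = (\<Sum>W\<in>defining_words n (D2 \<union> D3) i. card (W \<inter> D2))"
proof -
  define DW where "DW = defining_words n (D2 \<union> D3) i"
  have fin: "finite DW" using assms by (simp add: DW_def finite_defining_words)
  have le: "card (W \<inter> D2) \<le> i" if "W \<in> DW" for W
    using that card_mono[of W "W \<inter> D2"] by (auto simp: DW_def defining_words_def)
  have "E_words n D2 D3 i = (\<Sum>p=1..i. \<Sum>W\<in>DW. if card (W \<inter> D2) = p then p else 0)"
    using fin by (simp add: E_words_def E_words_exact_def sum.If_cases Int_def mult.commute flip: DW_def)
  also have "\<dots> = (\<Sum>W\<in>DW. \<Sum>p=1..i. if card (W \<inter> D2) = p then p else 0)"
    by (rule sum.swap)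
  also have "\<dots> = (\<Sum>W\<in>DW. card (W \<inter> D2))"
  proof (rule sum.cong[OF refl])
    fix W assume "W \<in> DW"
    then show "(\<Sum>p=1..i. if card (W \<inter> D2) = p then p else 0) = card (W \<inter> D2)"
      using le[of W] by (auto simp: sum.delta)
  qed
  finally show ?thesis by (simp add: DW_def)
qed

text \<open>A word is lost for \<open>d\<close> precisely if \<open>d\<close> is one of its letters, so over all \<open>d\<close> it is lost once
  for each of its letters in \<open>D2\<close>.\<close>

lemma sum_A_words_delete:
  assumes "finite (D2 \<union> D3)"
  shows "(\<Sum>d\<in>D2. real (A_words n (D2 \<union> D3 - {d}) i))
    = real (card D2) * real (A_words n (D2 \<union> D3) i) - real (E_words n D2 D3 i)"
proof -
  define DW where "DW = defining_words n (D2 \<union> D3) i"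
  have fin: "finite DW" "finite D2" using assms by (simp_all add: DW_def finite_defining_words)
  have A: "A_words n (D2 \<union> D3 - {d}) i + (\<Sum>W\<in>DW. if d \<in> W then 1 else 0) = A_words n (D2 \<union> D3) i"
    for d
  proof -
    have "defining_words n (D2 \<union> D3 - {d}) i = DW - {W \<in> DW. d \<in> W}"
      by (auto simp: DW_def defining_words_def)
    moreover have "card (DW - {W \<in> DW. d \<in> W}) + card {W \<in> DW. d \<in> W} = card DW"
      using fin card_mono[of DW "{W \<in> DW. d \<in> W}"] by (simp add: card_Diff_subset)
    ultimately show ?thesis
      using fin by (simp add: A_words_def sum.If_cases Int_def flip: DW_def)
  qed
  have "(\<Sum>d\<in>D2. A_words n (D2 \<union> D3 - {d}) i) + E_words n D2 D3 i
      = (\<Sum>d\<in>D2. A_words n (D2 \<union> D3 - {d}) i) + (\<Sum>W\<in>DW. \<Sum>d\<in>D2. if d \<in> W then 1 else 0)"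
    using fin by (simp add: E_words_eq_sum_card[OF assms] sum.If_cases Int_commute flip: DW_def)
  also have "\<dots> = (\<Sum>d\<in>D2. A_words n (D2 \<union> D3 - {d}) i + (\<Sum>W\<in>DW. if d \<in> W then 1 else 0))"
    unfolding sum.distrib by (subst sum.swap) (rule refl)
  also have "\<dots> = card D2 * A_words n (D2 \<union> D3) i" by (simp only: A sum_constant) simp
  finally have "real ((\<Sum>d\<in>D2. A_words n (D2 \<union> D3 - {d}) i) + E_words n D2 D3 i)
      = real (card D2 * A_words n (D2 \<union> D3) i)" by (rule arg_cong)
  then show ?thesis by simp
qed

theorem theorem2:
  fixes k m S j :: nat and H :: "int mat" and D1 D2 D3 :: "int vec set"
  assumes "saturated_design k H"
    and "D1 \<union> D2 \<union> D3 = set (cols H)"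
    and "D1 \<inter> D2 = {}" and "D1 \<inter> D3 = {}" and "D2 \<inter> D3 = {}"
    and "card D1 = m" and "card D2 = S"
    and "2 \<le> j" and "j \<le> m"
  shows "N_words (2 ^ k) m D1 D2 j =
      (\<Sum>i=0..j+1. ((real j + 1 - real S) * c_coeff k (int m) i (j + 1)
                     + real S * c_coeff k (int m + 1) i (j + 1))
                   * real (A_words (2 ^ k) (D2 \<union> D3) i))
      - (\<Sum>i=0..j+1. c_coeff k (int m + 1) i (j + 1) * real (E_words (2 ^ k) D2 D3 i))
      + (real m - real j + 1)
        * (\<Sum>i=0..j-1. c_coeff k (int m) i (j - 1) * real (A_words (2 ^ k) (D2 \<union> D3) i))"
proof -
  let ?A = "\<lambda>D i. real (A_words (2 ^ k) D i)"
  let ?c = "\<lambda>i. c_coeff k (int m) i (j + 1)" and ?c' = "\<lambda>i. c_coeff k (int m + 1) i (j + 1)"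
  have fin: "finite (D1 \<union> D2 \<union> D3)" using assms(2) by simp
  have k: "1 \<le> k"
  proof -
    have "m \<le> 2 ^ k - 1"
      using saturated_design_card[OF assms(1)] assms(2,6) card_mono[OF fin, of D1] by auto
    then have "(2 :: nat) ^ k \<noteq> 1" using assms(8,9) by linarith
    then show ?thesis by (cases k) auto
  qed
  have A1: "?A D1 l = (\<Sum>i=0..l. c_coeff k (int m) i l * ?A (D2 \<union> D3) i)" for l
    using A_words_complement[OF assms(1) k, of D1 "D2 \<union> D3" l] assms(2-6) by auto
  have A_insert: "?A (insert d D1) (j + 1) = (\<Sum>i=0..j+1. ?c' i * ?A (D2 \<union> D3 - {d}) i)"
    if d: "d \<in> D2" for d
  proof -
    have "card (insert d D1) = m + 1" using d assms(3,6) fin by (subst card_insert_disjoint) auto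
    moreover have "insert d D1 \<union> (D2 \<union> D3 - {d}) = set (cols H)"
      using d assms(2) by blast
    moreover have "insert d D1 \<inter> (D2 \<union> D3 - {d}) = {}"
      using assms(3,4) by blast
    ultimately show ?thesis
      using A_words_complement[OF assms(1) k, of "insert d D1" "D2 \<union> D3 - {d}" "j + 1"]
      by (simp add: add.commute)
  qed
  have "real (B_words (2 ^ k) D1 D2 j) = (\<Sum>d\<in>D2. ?A (insert d D1) (j + 1)) - real S * ?A D1 (j + 1)"
    using B_words_eq_sum_A_words[of D1 D2 "2 ^ k" j] fin assms(3,7) by (simp add: sum_subtractf)
  also have "(\<Sum>d\<in>D2. ?A (insert d D1) (j + 1))
      = (\<Sum>d\<in>D2. \<Sum>i=0..j+1. ?c' i * ?A (D2 \<union> D3 - {d}) i)"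
    by (rule sum.cong[OF refl A_insert])
  also have "\<dots> = (\<Sum>i=0..j+1. ?c' i * (\<Sum>d\<in>D2. ?A (D2 \<union> D3 - {d}) i))"
    unfolding sum_distrib_left by (rule sum.swap)
  also have "\<dots> = (\<Sum>i=0..j+1. ?c' i * (real S * ?A (D2 \<union> D3) i - real (E_words (2 ^ k) D2 D3 i)))"
    using fin assms(7) by (simp only: sum_A_words_delete finite_Un)
  finally have B: "real (B_words (2 ^ k) D1 D2 j)
      = (\<Sum>i=0..j+1. ?c' i * (real S * ?A (D2 \<union> D3) i - real (E_words (2 ^ k) D2 D3 i)))
        - real S * ?A D1 (j + 1)" .
  have "N_words (2 ^ k) m D1 D2 j
      = ((real j + 1 - real S) * ?A D1 (j + 1)
          + (\<Sum>i=0..j+1. ?c' i * (real S * ?A (D2 \<union> D3) i - real (E_words (2 ^ k) D2 D3 i))))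
        + (real m - real j + 1) * ?A D1 (j - 1)"
    unfolding N_words_def B by (simp add: algebra_simps)
  also have "(real j + 1 - real S) * ?A D1 (j + 1)
          + (\<Sum>i=0..j+1. ?c' i * (real S * ?A (D2 \<union> D3) i - real (E_words (2 ^ k) D2 D3 i)))
      = (\<Sum>i=0..j+1. ((real j + 1 - real S) * ?c i + real S * ?c' i) * ?A (D2 \<union> D3) i)
        - (\<Sum>i=0..j+1. ?c' i * real (E_words (2 ^ k) D2 D3 i))"
    unfolding A1 sum_distrib_left sum_subtractf[symmetric] sum.distrib[symmetric]
    by (rule sum.cong[OF refl]) (simp add: algebra_simps)
  finally show ?thesis by (simp only: A1)
qed

end
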